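(* Let $n\geq 2$, let $c,x\in\mathbb{R}^n$ and $p,r,\delta>0$ satisfy $|c-x|=p+r+\delta$, and let $k\geq\max(|c|,|x|)$. Let $W$ be uniformly distributed on $\mathbb{S}^{n-1}$ and $\beta$ uniformly distributed on $[-k,k]$, with $W$ and $\beta$ independent. Put $\mathcal{Q}=1-\bigl(\frac{p+r}{p+r+\delta}\bigr)^2$. Then $$\mathbb{P}_{W,\beta}\{\mathsf{H}[W;\beta]\text{ separates }\mathsf{B}[c,r]\text{ and }\mathsf{B}[x,p]\}=\frac{|c-x|}{2k}\left(\frac{\mathcal{Q}^{(n-1)/2}}{\frac{n-1}{2}B\bigl(\frac{n-1}{2},\frac12\bigr)}-\frac{p+r}{p+r+\delta}\,I\bigl(\mathcal{Q};\tfrac{n-1}{2},\tfrac12\bigr)\right).$$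
   Context: $(\cdot\mid\cdot)$ and $|\cdot|$ are the Euclidean inner product and norm on $\mathbb{R}^n$, and $\mathbb{S}^{n-1}=\{u\in\mathbb{R}^n:|u|=1\}$. For $c\in\mathbb{R}^n$, $r>0$, $\mathsf{B}[c,r]=\{u\in\mathbb{R}^n:|c-u|<r\}$. For $w\in\mathbb{S}^{n-1}$ and $b\in\mathbb{R}$, $\mathsf{H}[w;b]=\{u\in\mathbb{R}^n:(w\mid u)-b=0\}$. The hyperplane $\mathsf{H}[w;b]$ separates $\mathsf{B}[c,r]$ and $\mathsf{B}[x,p]$ if either $(w\mid u)-b>0$ for all $u\in\mathsf{B}[c,r]$ and $(w\mid u)-b<0$ for all $u\in\mathsf{B}[x,p]$, or $(w\mid u)-b<0$ for all $u\in\mathsf{B}[c,r]$ and $(w\mid u)-b>0$ for all $u\in\mathsf{B}[x,p]$. $B(y,z)$ is the beta function, and the regularized beta function is $I(\kappa;y,z)=\frac{1}{B(y,z)}\int_0^{\kappa}s^{y-1}(1-s)^{z-1}\,ds$ for $y,z>0$ and $\kappa\in[0,1]$. *)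

theory Defs
  imports "HOL-Probability.Probability"
begin

(* The hyperplane {u. w \<bullet> u - b = 0} is represented by its parameters: a normal vector w
   (of norm 1 in all uses) and an offset b. *)
definition hyperplane_separates ::
    "'a::real_inner \<Rightarrow> real \<Rightarrow> 'a set \<Rightarrow> 'a set \<Rightarrow> bool" where
  "hyperplane_separates w b A B \<longleftrightarrow>
     (\<forall>u\<in>A. w \<bullet> u - b > 0) \<and> (\<forall>u\<in>B. w \<bullet> u - b < 0) \<or>
     (\<forall>u\<in>A. w \<bullet> u - b < 0) \<and> (\<forall>u\<in>B. w \<bullet> u - b > 0)"

(* Meant for y, z > 0 and 0 \<le> \<kappa> \<le> 1. If y < 1, the true integrand is unbounded at s = 0, where
   powr takes the value 0; this does not change the integral. *)
definition regularized_beta :: "real \<Rightarrow> real \<Rightarrow> real \<Rightarrow> real" where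
  "regularized_beta \<kappa> y z =
     1 / Beta y z * integral {0..\<kappa>} (\<lambda>s. s powr (y - 1) * (1 - s) powr (z - 1))"

(* The uniform distribution on the unit sphere, as a Borel measure on the ambient space: the
   normalized cone measure, i.e. the law of U / norm U for U uniformly distributed on the unit
   ball. It is the rotation-invariant probability measure concentrated on the sphere, as the
   lemmas below confirm. *)
definition uniform_sphere :: "(real^'n) measure" where
  "uniform_sphere = distr (uniform_measure lborel (ball 0 1)) borel (\<lambda>u. u /\<^sub>R norm u)"

lemma sets_uniform_sphere [measurable_cong, simp]: "sets uniform_sphere = sets borel"
  by (simp add: uniform_sphere_def)

lemma space_uniform_sphere [simp]: "space uniform_sphere = UNIV"
  by (simp add: uniform_sphere_def)

lemma emeasure_lborel_unit_ball_pos: "emeasure lborel (ball (0::real^'n) 1) \<noteq> 0"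
  using content_ball_pos[of 1 "0::real^'n"] by (auto simp: measure_def)

lemma emeasure_lborel_unit_ball_finite: "emeasure lborel (ball (0::real^'n) 1) \<noteq> \<infinity>"
  using emeasure_lborel_ball_finite[of "0::real^'n" 1] by simp

lemma prob_space_uniform_ball: "prob_space (uniform_measure lborel (ball (0::real^'n) 1))"
  by (intro prob_space_uniform_measure emeasure_lborel_unit_ball_pos
      emeasure_lborel_unit_ball_finite)

lemma prob_space_uniform_sphere: "prob_space (uniform_sphere :: (real^'n) measure)"
  unfolding uniform_sphere_def
  by (intro prob_space.prob_space_distr prob_space_uniform_ball) simp

lemma AE_uniform_sphere: "AE w in (uniform_sphere :: (real^'n) measure). norm w = 1"
proof -
  have "AE u in lborel. u \<noteq> (0::real^'n)"
    by (rule AE_lborel_singleton)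
  then have "AE u in uniform_measure lborel (ball (0::real^'n) 1). norm (u /\<^sub>R norm u) = 1"
    by (intro AE_uniform_measureI) (auto elim!: eventually_mono)
  then show ?thesis
    unfolding uniform_sphere_def by (subst AE_distr_iff) auto
qed

lemma distr_lborel_orthogonal:
  fixes T :: "'a::euclidean_space \<Rightarrow> 'a"
  assumes T: "orthogonal_transformation T"
  shows "distr lborel borel T = lborel"
proof -
  have lin: "linear T" and nrm: "\<And>u. norm (T u) = norm u"
    using T by (auto simp: orthogonal_transformation)
  have mT [measurable]: "T \<in> borel_measurable borel"
    by (intro borel_measurable_continuous_onI linear_continuous_on)
       (simp add: lin linear_conv_bounded_linear[symmetric])
  define N where "N = distr lborel borel T"
  define B where "B = ball (0::'a) 1"
  have B [measurable]: "B \<in> sets borel"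
    by (simp add: B_def)
  have sets_N [measurable_cong, simp]: "sets N = sets borel" and space_N [simp]: "space N = UNIV"
    by (simp_all add: N_def)
  have ball_N: "emeasure N (ball 0 e) = emeasure lborel (ball (0::'a) e)" for e
  proof -
    have "T -` ball 0 e = ball 0 e"
      by (auto simp: nrm)
    then show ?thesis
      by (simp add: N_def emeasure_distr)
  qed
  have transl: "distr N borel ((+) y) = N" for y
  proof -
    obtain z where z: "y = T z"
      using orthogonal_transformation_surj[OF T] by (metis surjD)
    have "distr N borel ((+) y) = distr (distr lborel borel ((+) z)) borel T"
      by (simp add: N_def distr_distr comp_def z linear_add[OF lin])
    then show ?thesis
      by (simp add: N_def lborel_distr_plus)
  qed
  have sf: "sigma_finite_measure N"
  proof
    have "range (\<lambda>k::nat. ball (0::'a) (real k)) \<subseteq> sets N" by auto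
    moreover have "(\<Union>k::nat. ball (0::'a) (real k)) = UNIV"
      by (auto simp: reals_Archimedean2)
    ultimately show "\<exists>F. countable F \<and> F \<subseteq> sets N \<and> \<Union>F = space N \<and> (\<forall>a\<in>F. emeasure N a \<noteq> \<infinity>)"
      by (intro exI[of _ "range (\<lambda>k::nat. ball (0::'a) (real k))"])
         (auto simp: ball_N emeasure_lborel_ball_finite[THEN less_imp_neq, simplified])
  qed
  interpret P: pair_sigma_finite N "lborel :: 'a measure"
    using sf by (simp add: pair_sigma_finite_def lborel.sigma_finite_measure_axioms)
  have refl_transl: "emeasure lborel {y. x - y \<in> A} = emeasure lborel A"
    if [measurable]: "A \<in> sets borel" for A and x :: 'a
  proof -
    have "distr lborel borel (\<lambda>y. x - y) = lborel"
      using lborel_affine[of "-1" x] by (simp add: density_1 one_ennreal_def[symmetric])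
    then show ?thesis
      using emeasure_distr[of "\<lambda>y. x - y" lborel borel A] by (simp add: vimage_def)
  qed
  have "N = lborel"
  proof (rule measure_eqI)
    fix A assume "A \<in> sets N"
    then have A [measurable]: "A \<in> sets borel" by simp
    have "emeasure N A * emeasure lborel B =
        (\<integral>\<^sup>+x. indicator A x * emeasure lborel B \<partial>N)"
      by (simp add: nn_integral_multc)
    also have "\<dots> = (\<integral>\<^sup>+x. \<integral>\<^sup>+y. indicator A x * indicator B (x + y) \<partial>lborel \<partial>N)"
    proof (rule nn_integral_cong)
      fix x :: 'a
      have "emeasure lborel B = (\<integral>\<^sup>+y. indicator B y \<partial>distr lborel borel ((+) x))"
        by (simp add: lborel_distr_plus)
      also have "\<dots> = (\<integral>\<^sup>+y. indicator B (x + y) \<partial>lborel)"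
        by (subst nn_integral_distr) auto
      finally show "indicator A x * emeasure lborel B =
          (\<integral>\<^sup>+y. indicator A x * indicator B (x + y) \<partial>lborel)"
        by (simp add: nn_integral_cmult)
    qed
    also have "\<dots> = (\<integral>\<^sup>+y. \<integral>\<^sup>+x. indicator A x * indicator B (x + y) \<partial>N \<partial>lborel)"
      by (rule P.Fubini'[symmetric]) measurable
    also have "\<dots> = (\<integral>\<^sup>+y. \<integral>\<^sup>+x. indicator A (x - y) * indicator B x \<partial>N \<partial>lborel)"
    proof (rule nn_integral_cong)
      fix y :: 'a
      have "(\<integral>\<^sup>+x. indicator A (x - y) * indicator B x \<partial>N) =
          (\<integral>\<^sup>+x. indicator A (x - y) * indicator B x \<partial>distr N borel ((+) y))"
        by (simp add: transl)
      also have "\<dots> = (\<integral>\<^sup>+x. indicator A x * indicator B (x + y) \<partial>N)"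
        by (subst nn_integral_distr) (auto simp: add.commute)
      finally show "(\<integral>\<^sup>+x. indicator A x * indicator B (x + y) \<partial>N) =
          (\<integral>\<^sup>+x. indicator A (x - y) * indicator B x \<partial>N)" ..
    qed
    also have "\<dots> = (\<integral>\<^sup>+x. \<integral>\<^sup>+y. indicator A (x - y) * indicator B x \<partial>lborel \<partial>N)"
      by (rule P.Fubini') measurable
    also have "\<dots> = (\<integral>\<^sup>+x. emeasure lborel A * indicator B x \<partial>N)"
    proof (rule nn_integral_cong)
      fix x :: 'a
      have "(\<integral>\<^sup>+y. indicator A (x - y) \<partial>lborel) =
          (\<integral>\<^sup>+y. indicator {y. x - y \<in> A} y \<partial>lborel)"
        by (intro nn_integral_cong) (auto simp: indicator_def)
      also have "\<dots> = emeasure lborel A"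
        by (subst nn_integral_indicator) (auto simp: refl_transl)
      finally show "(\<integral>\<^sup>+y. indicator A (x - y) * indicator B x \<partial>lborel) =
          emeasure lborel A * indicator B x"
        by (simp add: nn_integral_multc)
    qed
    also have "\<dots> = emeasure lborel A * emeasure lborel B"
      using ball_N[of 1] by (simp add: nn_integral_cmult_indicator B_def[symmetric])
    finally have "emeasure N A * emeasure lborel B = emeasure lborel A * emeasure lborel B" .
    moreover have "emeasure lborel B \<noteq> 0"
      using content_ball_pos[of 1 "0::'a"] by (auto simp: measure_def B_def)
    moreover have "emeasure lborel B < \<infinity>"
      unfolding B_def by (rule emeasure_lborel_ball_finite)
    ultimately show "emeasure N A = emeasure lborel A"
      by (auto simp: ennreal_mult_cancel_left mult.commute[of _ "emeasure lborel B"])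
  qed simp
  then show ?thesis by (simp add: N_def)
qed

lemma uniform_sphere_orthogonal_invariant:
  fixes T :: "real^'n \<Rightarrow> real^'n"
  assumes T: "orthogonal_transformation T"
  shows "distr uniform_sphere borel T = uniform_sphere"
proof (rule measure_eqI)
  let ?B = "ball (0::real^'n) 1"
  let ?p = "\<lambda>u::real^'n. u /\<^sub>R norm u"
  have lin: "linear T" and nrm: "\<And>u. norm (T u) = norm u"
    using T by (auto simp: orthogonal_transformation)
  have mT [measurable]: "T \<in> borel_measurable borel"
    by (intro borel_measurable_continuous_onI linear_continuous_on)
       (simp add: lin linear_conv_bounded_linear[symmetric])
  have *: "emeasure uniform_sphere X = emeasure lborel (?B \<inter> ?p -` X) / emeasure lborel ?B"
    if [measurable]: "X \<in> sets borel" for X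
    unfolding uniform_sphere_def using measurable_sets[of ?p borel borel X]
    by (subst emeasure_distr) auto
  fix A :: "(real^'n) set"
  assume "A \<in> sets (distr uniform_sphere borel T)"
  then have A [measurable]: "A \<in> sets borel" by simp
  have S [measurable]: "?B \<inter> ?p -` A \<in> sets borel"
    using measurable_sets[of ?p borel borel A] by auto
  have TA: "T -` A \<in> sets borel"
    using measurable_sets[OF mT A] by simp
  have "?B \<inter> ?p -` (T -` A) = T -` (?B \<inter> ?p -` A)"
    by (auto simp: nrm linear_cmul[OF lin])
  then have "emeasure lborel (?B \<inter> ?p -` (T -` A)) =
      emeasure (distr lborel borel T) (?B \<inter> ?p -` A)"
    using S by (simp add: emeasure_distr)
  also have "\<dots> = emeasure lborel (?B \<inter> ?p -` A)"
    by (simp only: distr_lborel_orthogonal[OF T])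
  finally show "emeasure (distr uniform_sphere borel T) A = emeasure uniform_sphere A"
    using TA A by (subst emeasure_distr) (auto simp: *)
qed simp

end

(* A hyperplane with unit normal w separates the balls iff its offset lies in one of two disjoint
   intervals inside [-k, k], of total length (|w . (c - x)| - (p + r))_+. Averaging over the offset
   and using rotation invariance, everything reduces to E (W . e - a)_+ for a unit vector e and
   a = (p + r) / |c - x|, i.e. to integrating the cap probabilities P (W . e >= t) over t >= a.
   Such a cap is the trace of a circular cone; slicing the cone orthogonally to e gives
   (n - 1)-dimensional balls, so its volume in the unit ball is a one-dimensional integral, and
   P (W . e >= t) = J t / (2 B), where B = B((n - 1)/2, 1/2) and J t is the incomplete beta
   integral up to 1 - t^2. All remaining integrals follow from J' t = - 2 (1 - t^2)^((n - 3)/2). *)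
theory Submission
  imports Defs
begin

section \<open>The incomplete beta integral and its antiderivatives\<close>

text \<open>The unnormalised incomplete beta function B(q; m, 1/2) at q = 1 - t^2, parametrised by
  the height t of a spherical cap. In the application m = (n - 1)/2.\<close>

definition beta_tail :: "real \<Rightarrow> real \<Rightarrow> real" where
  "beta_tail m t = integral {0..1 - t\<^sup>2} (\<lambda>s. s powr (m - 1) * (1 - s) powr (1 / 2 - 1))"

lemma beta_tail_1 [simp]: "beta_tail m 1 = 0"
  by (simp add: beta_tail_def)

context
  fixes m :: real
  assumes m: "m > 0"
begin

lemma beta_integrand_integrable:
  "(\<lambda>s. s powr (m - 1) * (1 - s) powr (1 / 2 - 1 :: real)) integrable_on {0..1}"
  using has_integral_Beta_real[of m "1/2"] m by (auto simp: integrable_on_def)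

lemma continuous_on_beta_tail: "continuous_on {0..1} (beta_tail m)"
proof -
  have "continuous_on {0..1} (\<lambda>q. integral {0..q} (\<lambda>s. s powr (m - 1) * (1 - s) powr (1 / 2 - 1 :: real)))"
    by (intro indefinite_integral_continuous_1 beta_integrand_integrable)
  then show ?thesis
    unfolding beta_tail_def
    by (rule continuous_on_compose2) (auto intro!: continuous_intros simp: power_le_one)
qed

lemma beta_tail_nonneg: "beta_tail m t \<ge> 0"
  unfolding beta_tail_def
  \<comment> \<open>A non-integrable function has integral 0 by default, so the case split settles
    every real t without an integrability proof on the subinterval.\<close>
  by (cases "(\<lambda>s. s powr (m - 1) * (1 - s) powr (1 / 2 - 1 :: real)) integrable_on {0..1 - t\<^sup>2}")
    (auto intro!: integral_nonneg simp: not_integrable_integral)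

text \<open>Fundamental theorem and chain rule: at s = 1 - t^2 the factor (1 - s)^(-1/2) equals 1/t
  and cancels the t of the inner derivative -2t.\<close>

lemma has_real_derivative_beta_tail:
  assumes t: "0 < t" "t < 1"
  shows "(beta_tail m has_real_derivative - 2 * (1 - t\<^sup>2) powr (m - 1)) (at t)"
proof -
  let ?f = "\<lambda>s. s powr (m - 1) * (1 - s) powr (1 / 2 - 1 :: real)"
  have q: "0 < 1 - t\<^sup>2" "1 - t\<^sup>2 < 1"
    using t by (auto simp: power_less_one_iff)
  have "continuous (at (1 - t\<^sup>2) within {0..1} - {}) ?f"
    by (rule continuous_at_imp_continuous_at_within) (use q t in \<open>intro continuous_intros; auto\<close>)
  moreover have "1 - t\<^sup>2 \<in> {0..1} - {}" using q by auto
  ultimately have "((\<lambda>q. integral {0..q} ?f) has_vector_derivative ?f (1 - t\<^sup>2))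
      (at (1 - t\<^sup>2) within {0..1} - {})"
    by (intro integral_has_vector_derivative_continuous_at[OF beta_integrand_integrable _ finite.emptyI])
  then have "((\<lambda>q. integral {0..q} ?f) has_real_derivative ?f (1 - t\<^sup>2)) (at (1 - t\<^sup>2))"
    unfolding has_real_derivative_iff_has_vector_derivative
    using at_within_Icc_at[OF q] by (simp only: Diff_empty)
  moreover have "((\<lambda>t. 1 - t\<^sup>2) has_real_derivative - 2 * t) (at t)"
    by (auto intro!: derivative_eq_intros)
  ultimately have "(beta_tail m has_real_derivative ?f (1 - t\<^sup>2) * (- 2 * t)) (at t)"
    unfolding beta_tail_def[abs_def]
    by (rule DERIV_chain2[where f = "\<lambda>q. integral {0..q} ?f" and g = "\<lambda>t. 1 - t\<^sup>2"])
  also have "(t\<^sup>2) powr (1 / 2 - 1) * t = 1"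
    using t powr_powr[of t 2 "-1/2"] by (simp add: powr_minus)
  then have "?f (1 - t\<^sup>2) * (- 2 * t) = - 2 * (1 - t\<^sup>2) powr (m - 1)"
    by (simp add: mult_ac)
  finally show ?thesis .
qed

lemma continuous_on_one_minus_square_powr:
  "continuous_on {0..1} (\<lambda>t::real. (1 - t\<^sup>2) powr m)"
  using m by (intro continuous_on_powr' continuous_intros) (auto simp: power_le_one)

lemma has_real_derivative_one_minus_square_powr:
  assumes s: "0 < s" "s < 1"
  shows "((\<lambda>t. (1 - t\<^sup>2) powr m) has_real_derivative m * (1 - s\<^sup>2) powr (m - 1) * (- 2 * s)) (at s)"
proof (rule DERIV_chain2[OF has_real_derivative_powr])
  show "1 - s\<^sup>2 > 0" using s by (auto simp: power_less_one_iff)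
  show "((\<lambda>t. 1 - t\<^sup>2) has_real_derivative - 2 * s) (at s)"
    by (auto intro!: derivative_eq_intros)
qed

text \<open>The derivative of s (1 - s^2)^m is (2m + 1) (1 - s^2)^m - 2m (1 - s^2)^(m - 1), and the
  derivative of -m \<open>beta_tail m s\<close> cancels the last term. The interior form of the
  fundamental theorem is used because (1 - s^2)^(m - 1) blows up at s = 1 if m < 1.\<close>

lemma has_integral_one_minus_square_powr:
  assumes t: "0 < t" "t < 1"
  shows "((\<lambda>s. (1 - s\<^sup>2) powr m) has_integral
    (m * beta_tail m t - t * (1 - t\<^sup>2) powr m) / (2 * m + 1)) {t..1}"
proof -
  let ?F = "\<lambda>s. (s * (1 - s\<^sup>2) powr m - m * beta_tail m s) / (2 * m + 1)"
  have "((\<lambda>s. (1 - s\<^sup>2) powr m) has_integral ?F 1 - ?F t) {t..1}"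
  proof (rule fundamental_theorem_of_calculus_interior)
    show "continuous_on {t..1} ?F"
      using t m by (intro continuous_intros continuous_on_subset[OF continuous_on_one_minus_square_powr]
          continuous_on_subset[OF continuous_on_beta_tail]) auto
  next
    fix s :: real assume s: "s \<in> {t<..<1}"
    then have s': "0 < s" "s < 1" "s\<^sup>2 < 1" using t by (auto simp: power_less_one_iff)
    have *: "(1 - s\<^sup>2) powr m = (1 - s\<^sup>2) * (1 - s\<^sup>2) powr (m - 1)"
      using s' powr_add[of "1 - s\<^sup>2" 1 "m - 1"] by simp
    have "(?F has_real_derivative (1 * (1 - s\<^sup>2) powr m
        + m * (1 - s\<^sup>2) powr (m - 1) * (- 2 * s) * s
        - m * (- 2 * (1 - s\<^sup>2) powr (m - 1))) / (2 * m + 1)) (at s)"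
      by (intro DERIV_diff DERIV_mult DERIV_ident DERIV_cmult DERIV_cdivide
          has_real_derivative_beta_tail has_real_derivative_one_minus_square_powr s'(1,2))
    also have "(1 * (1 - s\<^sup>2) powr m + m * (1 - s\<^sup>2) powr (m - 1) * (- 2 * s) * s
        - m * (- 2 * (1 - s\<^sup>2) powr (m - 1))) / (2 * m + 1) = (1 - s\<^sup>2) powr m"
      using m unfolding * by (simp add: field_simps power2_eq_square)
    finally show "(?F has_vector_derivative (1 - s\<^sup>2) powr m) (at s)"
      by (simp add: has_real_derivative_iff_has_vector_derivative)
  qed (use t in auto)
  also have "?F 1 - ?F t = (m * beta_tail m t - t * (1 - t\<^sup>2) powr m) / (2 * m + 1)"
    using m by (simp add: field_simps)
  finally show ?thesis .
qed

text \<open>Integration by parts: the derivative of s \<open>beta_tail m s\<close> exceeds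
  \<open>beta_tail m s\<close> by -2s (1 - s^2)^(m - 1), which is the derivative of (1 - s^2)^m /
  m.\<close>

lemma has_integral_beta_tail:
  assumes a: "0 < a" "a < 1"
  shows "(beta_tail m has_integral (1 - a\<^sup>2) powr m / m - a * beta_tail m a) {a..1}"
proof -
  let ?F = "\<lambda>s. s * beta_tail m s - (1 - s\<^sup>2) powr m / m"
  have "(beta_tail m has_integral ?F 1 - ?F a) {a..1}"
  proof (rule fundamental_theorem_of_calculus_interior)
    show "continuous_on {a..1} ?F"
      using a m by (intro continuous_intros continuous_on_subset[OF continuous_on_one_minus_square_powr]
          continuous_on_subset[OF continuous_on_beta_tail]) auto
  next
    fix s :: real assume s: "s \<in> {a<..<1}"
    then have s': "0 < s" "s < 1" "s\<^sup>2 < 1" using a by (auto simp: power_less_one_iff)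
    have "(?F has_real_derivative 1 * beta_tail m s + (- 2 * (1 - s\<^sup>2) powr (m - 1)) * s
        - m * (1 - s\<^sup>2) powr (m - 1) * (- 2 * s) / m) (at s)"
      by (intro DERIV_diff DERIV_mult DERIV_ident DERIV_cdivide has_real_derivative_beta_tail
          has_real_derivative_one_minus_square_powr s'(1,2))
    then have "(?F has_real_derivative beta_tail m s) (at s)"
      using m by (simp add: mult_ac)
    then show "(?F has_vector_derivative beta_tail m s) (at s)"
      by (simp add: has_real_derivative_iff_has_vector_derivative)
  qed (use a in auto)
  then show ?thesis by simp
qed

end

section \<open>Volume of a circular cone inside the unit ball\<close>

text \<open>Turns the constant of the cone volume into a multiple of the ball volume, for dimensions
  2m and 2m + 1. Everything reduces to Gamma(z + 1) = z Gamma(z) at z = m and z = m + 1/2, and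
  Gamma(1/2) = sqrt pi.\<close>

lemma unit_ball_vol_step:
  assumes "m > 0"
  shows "unit_ball_vol (2 * m) * m / (2 * m + 1) =
    unit_ball_vol (2 * m + 1) / (2 * Beta m (1 / 2))"
proof -
  define h where "h = m + 1/2"
  have h: "h > 0" "2 * m + 1 = 2 * h" "m = h - 1/2" using assms by (simp_all add: h_def)
  have g: "Gamma (z + 1) = z * Gamma z" if "z > 0" for z :: real
    using that by (intro Gamma_plus1) (auto elim!: nonpos_Ints_cases)
  have p: "pi powr h = pi powr m * sqrt pi"
    by (simp add: h_def powr_add powr_half_sqrt)
  have pos: "Gamma m \<noteq> 0" "Gamma h \<noteq> 0"
    using Gamma_real_pos[OF assms] Gamma_real_pos[OF h(1)] by linarith+
  have "unit_ball_vol (2 * m) * m / (2 * m + 1) = pi powr m / Gamma m / (2 * h)"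
    using assms g[of m] h(2) by (simp add: unit_ball_vol_def)
  moreover have "Beta m (1 / 2) = Gamma m * sqrt pi / Gamma h"
    by (simp add: Beta_def Gamma_one_half_real h_def)
  moreover have "unit_ball_vol (2 * m + 1) = pi powr m * sqrt pi / (h * Gamma h)"
    using g[of h] h(1) p unfolding h(2) by (simp add: unit_ball_vol_def)
  ultimately show ?thesis
    using pos h(1) by simp
qed

text \<open>Positivity of \<open>N\<close> matters at y = 0: there 0^0 would be 1, while
  \<open>0 powr 0\<close> is 0.\<close>

lemma sqrt_power_eq_powr:
  assumes "0 \<le> y" "N > 0"
  shows "sqrt y ^ N = y powr (real N / 2)"
  using assms by (cases "y = 0") (auto simp: powr_power simp flip: powr_half_sqrt)

text \<open>Here \<open>s\<close> is the coordinate along the axis of the cone and \<open>q\<close> the squared distance from the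
  axis. The cone bounds the slice for \<open>s \<le> t\<close>, the unit ball bounds it for \<open>s \<ge> t\<close>.\<close>

lemma cone_slice_iff:
  fixes s t q :: real
  assumes t: "0 < t" "t < 1" and q: "0 \<le> q"
  shows "sqrt (s\<^sup>2 + q) \<le> 1 \<and> t * sqrt (s\<^sup>2 + q) \<le> s \<longleftrightarrow>
    0 \<le> s \<and> s \<le> 1 \<and> q \<le> (if s \<le> t then s\<^sup>2 * (1 / t\<^sup>2 - 1) else 1 - s\<^sup>2)"
proof (cases "0 \<le> s")
  case False
  then show ?thesis
    using t q by (smt (verit) mult_nonneg_nonneg real_sqrt_ge_zero zero_le_power2)
next
  case True
  have "t * sqrt (s\<^sup>2 + q) = sqrt (t\<^sup>2 * (s\<^sup>2 + q))"
    using t by (simp add: real_sqrt_mult)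
  then have "t * sqrt (s\<^sup>2 + q) \<le> s \<longleftrightarrow> t\<^sup>2 * (s\<^sup>2 + q) \<le> s\<^sup>2"
    using True q by (simp add: real_sqrt_le_iff')
  also have "\<dots> \<longleftrightarrow> q \<le> s\<^sup>2 * (1 / t\<^sup>2 - 1)"
    using t by (simp add: field_simps)
  finally have 1: "t * sqrt (s\<^sup>2 + q) \<le> s \<longleftrightarrow> q \<le> s\<^sup>2 * (1 / t\<^sup>2 - 1)" .
  have 2: "sqrt (s\<^sup>2 + q) \<le> 1 \<longleftrightarrow> q \<le> 1 - s\<^sup>2"
    by auto
  have 3: "s \<le> 1" if "q \<le> 1 - s\<^sup>2"
    using that q True by (intro power2_le_imp_le[of s 1]) auto
  have 4: "s\<^sup>2 * (1 / t\<^sup>2 - 1) \<le> 1 - s\<^sup>2 \<longleftrightarrow> s\<^sup>2 \<le> t\<^sup>2"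
    using t by (simp add: field_simps)
  have 5: "s\<^sup>2 \<le> t\<^sup>2 \<longleftrightarrow> s \<le> t"
    using t True by (simp add: power2_le_iff_abs_le)
  show ?thesis
    using 1 2 3 4 5 True by (auto split: if_splits)
qed

text \<open>The square root is the radius of the slice at height s, so the integrand is its volume
  up to the factor \<open>unit_ball_vol N\<close>. The conical part over [0, t] contributes exactly
  the boundary term that the part over [t, 1] subtracts.\<close>

lemma has_integral_cone_slice:
  fixes t :: real
  assumes t: "0 < t" "t < 1" and N: "N > 0"
  defines "m \<equiv> real N / 2"
  shows "((\<lambda>s. sqrt (if s \<le> t then s\<^sup>2 * (1 / t\<^sup>2 - 1) else 1 - s\<^sup>2) ^ N) has_integral
    m * beta_tail m t / (2 * m + 1)) {0..1}"
proof -
  let ?f = "\<lambda>s. sqrt (if s \<le> t then s\<^sup>2 * (1 / t\<^sup>2 - 1) else 1 - s\<^sup>2) ^ N"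
  have m: "m > 0" "real N = 2 * m" using N by (simp_all add: m_def)
  have t2: "t\<^sup>2 < 1" using t by (simp add: power_less_one_iff)
  have "((\<lambda>s. s ^ N * sqrt (1 / t\<^sup>2 - 1) ^ N) has_integral
      t ^ Suc N / real (Suc N) * sqrt (1 / t\<^sup>2 - 1) ^ N -
      0 ^ Suc N / real (Suc N) * sqrt (1 / t\<^sup>2 - 1) ^ N) {0..t}"
    using t by (intro fundamental_theorem_of_calculus)
       (auto intro!: derivative_eq_intros simp del: power_Suc of_nat_Suc
         simp flip: has_real_derivative_iff_has_vector_derivative)
  also have "t ^ Suc N / real (Suc N) * sqrt (1 / t\<^sup>2 - 1) ^ N - 0 ^ Suc N / real (Suc N) * sqrt (1 / t\<^sup>2 - 1) ^ N
      = t * (t * sqrt (1 / t\<^sup>2 - 1)) ^ N / (2 * m + 1)"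
    by (simp add: power_mult_distrib m(2) add.commute)
  also have "t * sqrt (1 / t\<^sup>2 - 1) = sqrt (t\<^sup>2 * (1 / t\<^sup>2 - 1))"
    using t by (simp add: real_sqrt_mult)
  also have "t\<^sup>2 * (1 / t\<^sup>2 - 1) = 1 - t\<^sup>2"
    using t by (simp add: field_simps)
  also have "sqrt (1 - t\<^sup>2) ^ N = (1 - t\<^sup>2) powr m"
    unfolding m_def using t2 N by (intro sqrt_power_eq_powr) auto
  finally have "((\<lambda>s. s ^ N * sqrt (1 / t\<^sup>2 - 1) ^ N) has_integral
      t * (1 - t\<^sup>2) powr m / (2 * m + 1)) {0..t}" .
  then have 1: "(?f has_integral t * (1 - t\<^sup>2) powr m / (2 * m + 1)) {0..t}"
    by (rule has_integral_eq[rotated]) (auto simp: real_sqrt_mult power_mult_distrib)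
  have "((\<lambda>s. (1 - s\<^sup>2) powr m) has_integral
      (m * beta_tail m t - t * (1 - t\<^sup>2) powr m) / (2 * m + 1)) {t..1}"
    by (rule has_integral_one_minus_square_powr[OF m(1) t])
  also have "?this \<longleftrightarrow> (?f has_integral (m * beta_tail m t - t * (1 - t\<^sup>2) powr m) / (2 * m + 1)) {t..1}"
  proof (intro has_integral_cong)
    fix s assume s: "s \<in> {t..1}"
    \<comment> \<open>The first branch applies only at s = t, where both bounds agree.\<close>
    have "(if s \<le> t then s\<^sup>2 * (1 / t\<^sup>2 - 1) else 1 - s\<^sup>2) = 1 - s\<^sup>2"
      using s t by (auto simp: field_simps)
    moreover have "s\<^sup>2 \<le> 1" using s t by (simp add: power_le_one)
    ultimately show "(1 - s\<^sup>2) powr m = ?f s"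
      unfolding m_def using N by (subst sqrt_power_eq_powr) auto
  qed
  finally have 2: "(?f has_integral (m * beta_tail m t - t * (1 - t\<^sup>2) powr m) / (2 * m + 1)) {t..1}" .
  have "t * (1 - t\<^sup>2) powr m / (2 * m + 1) + (m * beta_tail m t - t * (1 - t\<^sup>2) powr m) / (2 * m + 1)
      = m * beta_tail m t / (2 * m + 1)"
    by (simp flip: add_divide_distrib)
  with has_integral_combine[OF _ _ 1 2] t show ?thesis by simp
qed

text \<open>Cavalieri along \<open>e\<close>: Lebesgue measure is a product over the coordinates,
  the coordinate of \<open>e\<close> is split off, and the slice at height s is a ball of radius
  \<open>sqrt (h s)\<close> in the remaining \<open>N\<close> coordinates. Choosing \<open>e\<close>
  in \<open>Basis\<close> makes it a coordinate direction.\<close>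

lemma emeasure_half_cone:
  fixes e :: "'a::euclidean_space"
  assumes e: "e \<in> Basis" and dim: "DIM('a) \<ge> 2" and t: "0 < t" "t < 1"
  defines "m \<equiv> (real DIM('a) - 1) / 2"
  shows "emeasure lborel {u. norm u \<le> 1 \<and> t * norm u \<le> u \<bullet> e} =
    ennreal (unit_ball_vol (2 * m) * (m * beta_tail m t / (2 * m + 1)))"
proof -
  define A where "A = Basis - {e}"
  define N where "N = card A"
  define h where "h s = (if s \<le> t then s\<^sup>2 * (1 / t\<^sup>2 - 1) else 1 - s\<^sup>2)" for s
  let ?P = "\<lambda>I. Pi\<^sub>M I (\<lambda>_. lborel :: real measure)"
  interpret product_sigma_finite "\<lambda>_::'a. lborel :: real measure"
    by standard
  have A: "finite A" "e \<notin> A" "Basis = insert e A" "2 * m = real N" "N > 0" "m = real N / 2"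
    using e dim by (auto simp: A_def N_def m_def card_Diff_singleton of_nat_diff)
  have m: "m > 0" using A by simp
  have nrm: "norm u = sqrt (\<Sum>b\<in>Basis. (u \<bullet> b)\<^sup>2)" for u :: 'a
    using euclidean_dist_l2[of u 0] by (simp add: L2_set_def)
  define C where "C = {f \<in> space (?P (insert e A)). sqrt (\<Sum>b\<in>insert e A. (f b)\<^sup>2) \<le> 1 \<and>
    t * sqrt (\<Sum>b\<in>insert e A. (f b)\<^sup>2) \<le> f e}"
  have C [measurable]: "C \<in> sets (?P (insert e A))"
  proof -
    have [measurable]: "(\<lambda>f. f b) \<in> borel_measurable (?P (insert e A))" if "b \<in> insert e A" for b
      using measurable_component_singleton[OF that, of "\<lambda>_. lborel :: real measure"]
      by (simp only: measurable_lborel1)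
    have "(\<lambda>f. sqrt (\<Sum>b\<in>insert e A. (f b)\<^sup>2)) \<in> borel_measurable (?P (insert e A))"
      by measurable
    then show ?thesis
      unfolding C_def by (intro sets.sets_Collect_conj borel_measurable_le borel_measurable_times
          borel_measurable_const) auto
  qed
  have "emeasure lborel {u. norm u \<le> 1 \<and> t * norm u \<le> u \<bullet> e} =
      emeasure (distr (?P Basis) borel (\<lambda>f. \<Sum>b\<in>Basis. f b *\<^sub>R b)) {u. norm u \<le> 1 \<and> t * norm u \<le> u \<bullet> e}"
    by (subst lborel_eq) (rule refl)
  also have "\<dots> = emeasure (?P Basis) ((\<lambda>f. \<Sum>b\<in>Basis. f b *\<^sub>R b) -`
      {u. norm u \<le> 1 \<and> t * norm u \<le> u \<bullet> e} \<inter> space (?P Basis))"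
    by (subst emeasure_distr) auto
  also have "(\<lambda>f. \<Sum>b\<in>Basis. f b *\<^sub>R b) -` {u. norm u \<le> 1 \<and> t * norm u \<le> u \<bullet> e} \<inter> space (?P Basis) = C"
    using e unfolding C_def A(3)[symmetric] by (auto simp: nrm)
  also have "emeasure (?P Basis) C = (\<integral>\<^sup>+f. indicator C f \<partial>?P (insert e A))"
    unfolding A(3) by simp
  also have "\<dots> = (\<integral>\<^sup>+s. \<integral>\<^sup>+f. indicator C (f(e := s)) \<partial>?P A \<partial>lborel)"
    by (intro product_nn_integral_insert_rev A(1,2) borel_measurable_indicator C)
  also have "\<dots> = (\<integral>\<^sup>+s. \<integral>\<^sup>+f. indicator {0..1} s * indicator ({f. sqrt (\<Sum>b\<in>A. (f b)\<^sup>2) \<le> sqrt (h s)}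
      \<inter> space (?P A)) f \<partial>?P A \<partial>lborel)"
  proof (intro nn_integral_cong)
    fix s :: real and f assume f: "f \<in> space (?P A)"
    have "(\<Sum>b\<in>A. (if b = e then s else f b)\<^sup>2) = (\<Sum>b\<in>A. (f b)\<^sup>2)"
      using A(2) by (intro sum.cong) auto
    moreover have "f(e := s) \<in> space (?P (insert e A))"
      using f by (auto simp: space_PiM PiE_def extensional_def)
    ultimately have "f(e := s) \<in> C \<longleftrightarrow> sqrt (s\<^sup>2 + (\<Sum>b\<in>A. (f b)\<^sup>2)) \<le> 1 \<and>
        t * sqrt (s\<^sup>2 + (\<Sum>b\<in>A. (f b)\<^sup>2)) \<le> s"
      using A(1,2) by (simp add: C_def)
    also have "\<dots> \<longleftrightarrow> 0 \<le> s \<and> s \<le> 1 \<and> (\<Sum>b\<in>A. (f b)\<^sup>2) \<le> h s"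
      unfolding h_def by (intro cone_slice_iff t sum_nonneg) auto
    finally show "(indicator C (f(e := s)) :: ennreal) = indicator {0..1} s *
        indicator ({f. sqrt (\<Sum>b\<in>A. (f b)\<^sup>2) \<le> sqrt (h s)} \<inter> space (?P A)) f"
      using f by (auto simp: indicator_def)
  qed
  also have "\<dots> = (\<integral>\<^sup>+s. indicator {0..1} s * emeasure (?P A)
      ({f. sqrt (\<Sum>b\<in>A. (f b)\<^sup>2) \<le> sqrt (h s)} \<inter> space (?P A)) \<partial>lborel)"
    using A(1) by (intro nn_integral_cong) (subst nn_integral_cmult, auto)
  also have "\<dots> = (\<integral>\<^sup>+s. ennreal (unit_ball_vol (2 * m) * sqrt (h s) ^ N) * indicator {0..1} s \<partial>lborel)"
  proof (intro nn_integral_cong_AE)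
    \<comment> \<open>The ball volume formula \<open>emeasure_cball_aux\<close> wants a positive
      radius, but h vanishes at 0 and 1.\<close>
    have "AE s in lborel. s \<notin> {0, 1 :: real}"
      by (intro AE_not_in countable_imp_null_set_lborel) auto
    then show "AE s in lborel. indicator {0..1} s * emeasure (?P A)
        ({f. sqrt (\<Sum>b\<in>A. (f b)\<^sup>2) \<le> sqrt (h s)} \<inter> space (?P A)) =
        ennreal (unit_ball_vol (2 * m) * sqrt (h s) ^ N) * indicator {0..1} s"
    proof eventually_elim
      case (elim s)
      show ?case
      proof (cases "s \<in> {0<..<1}")
        case True
        then have "h s > 0"
          using t by (auto simp: h_def power_less_one_iff)
        then show ?thesis
          using True A(1) by (subst emeasure_cball_aux) (auto simp: A(4) N_def)
      qed (use elim in \<open>auto simp: indicator_def\<close>)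
    qed
  qed
  also have "\<dots> = ennreal (unit_ball_vol (2 * m) * (m * beta_tail m t / (2 * m + 1)))"
  proof (rule nn_integral_has_integral_lebesgue')
    show "((\<lambda>s. unit_ball_vol (2 * m) * sqrt (h s) ^ N) has_integral
        unit_ball_vol (2 * m) * (m * beta_tail m t / (2 * m + 1))) {0..1}"
      unfolding h_def A(6) by (intro has_integral_mult_right has_integral_cone_slice t A(5))
    fix s :: real assume "s \<in> {0..1}"
    then have "h s \<ge> 0"
      using t by (auto simp: h_def power_le_one)
    then show "0 \<le> unit_ball_vol (2 * m) * sqrt (h s) ^ N"
      using m by simp
  qed
  finally show ?thesis .
qed

section \<open>Offsets of separating hyperplanes\<close>

text \<open>By Cauchy-Schwarz the infimum of (w | u) over the ball is (w | c) - r |w|. The open ball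
  does not attain it, so the strict inequality on the left becomes a non-strict one on the
  right.\<close>

lemma ball_above_hyperplane_iff:
  fixes w c :: "'a::real_inner"
  assumes w: "w \<noteq> 0" and r: "r > 0"
  shows "(\<forall>u\<in>ball c r. w \<bullet> u - b > 0) \<longleftrightarrow> b \<le> w \<bullet> c - r * norm w"
proof
  assume *: "\<forall>u\<in>ball c r. w \<bullet> u - b > 0"
  show "b \<le> w \<bullet> c - r * norm w"
  proof (rule ccontr)
    assume "\<not> b \<le> w \<bullet> c - r * norm w"
    \<comment> \<open>The distance from the centre to the hyperplane, or 0 if the centre is already
      on the wrong side. Moving by s against w gives a point of the ball that violates the
      assumption.\<close>
    define s where "s = max 0 ((w \<bullet> c - b) / norm w)"
    have s: "0 \<le> s" "s < r" "w \<bullet> c - b \<le> s * norm w"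
      using \<open>\<not> b \<le> _\<close> w r by (auto simp: s_def field_simps max_def)
    have "c - (s / norm w) *\<^sub>R w \<in> ball c r"
      using s w by (simp add: dist_norm)
    moreover have "w \<bullet> (c - (s / norm w) *\<^sub>R w) = w \<bullet> c - s * norm w"
      using w by (simp add: inner_diff_right dot_square_norm power2_eq_square)
    ultimately have "w \<bullet> c - s * norm w - b > 0"
      using * by metis
    then show False
      using s(3) by simp
  qed
next
  assume b: "b \<le> w \<bullet> c - r * norm w"
  show "\<forall>u\<in>ball c r. w \<bullet> u - b > 0"
  proof
    fix u assume "u \<in> ball c r"
    then have "norm w * norm (c - u) < r * norm w"
      using w by (simp add: dist_norm mult.commute)
    moreover have "w \<bullet> (c - u) \<le> norm w * norm (c - u)"
      by (rule norm_cauchy_schwarz)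
    ultimately show "w \<bullet> u - b > 0"
      using b by (simp add: inner_diff_right)
  qed
qed

lemma ball_below_hyperplane_iff:
  fixes w c :: "'a::real_inner"
  assumes "w \<noteq> 0" "r > 0"
  shows "(\<forall>u\<in>ball c r. w \<bullet> u - b < 0) \<longleftrightarrow> w \<bullet> c + r * norm w \<le> b"
  using ball_above_hyperplane_iff[of "- w" r c "- b"] assms by (simp add: algebra_simps)

text \<open>The conjunct \<open>w \<noteq> 0\<close> makes the description valid for every w, so
  that it yields measurability of the separation event on the whole product space.\<close>

lemma hyperplane_separates_balls_iff:
  fixes w c x :: "'a::real_inner"
  assumes r: "r > 0" and p: "p > 0"
  shows "hyperplane_separates w b (ball c r) (ball x p) \<longleftrightarrow> w \<noteq> 0 \<and>
    (b \<in> {w \<bullet> x + p * norm w..w \<bullet> c - r * norm w} \<or> b \<in> {w \<bullet> c + r * norm w..w \<bullet> x - p * norm w})"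
proof (cases "w = 0")
  case True
  have "c \<in> ball c r" "x \<in> ball x p" using r p by auto
  then have "\<not> hyperplane_separates w b (ball c r) (ball x p)"
    unfolding hyperplane_separates_def True inner_zero_left
    by (metis less_asym diff_0)
  then show ?thesis using True by simp
next
  case False
  then show ?thesis
    using ball_above_hyperplane_iff[OF False r, of c b] ball_below_hyperplane_iff[OF False r, of c b]
      ball_above_hyperplane_iff[OF False p, of x b] ball_below_hyperplane_iff[OF False p, of x b]
    by (auto simp: hyperplane_separates_def)
qed

section \<open>Spherical caps and the mean excess over a threshold\<close>

text \<open>As the law of u / |u| for u uniform in the ball, the measure of a cap is the fraction of
  the ball filled by the cone over it.\<close>

lemma emeasure_uniform_sphere_cap_axis:
  fixes e :: "real^'n"
  assumes e: "e \<in> Basis" and dim: "CARD('n) \<ge> 2" and t: "0 < t" "t < 1"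
  defines "m \<equiv> (real CARD('n) - 1) / 2"
  shows "emeasure uniform_sphere {w. t \<le> w \<bullet> e} = ennreal (beta_tail m t / (2 * Beta m (1 / 2)))"
proof -
  have m: "m > 0" "2 * m + 1 = real CARD('n)" using dim by (simp_all add: m_def field_simps)
  let ?K = "{u::real^'n. norm u \<le> 1 \<and> t * norm u \<le> u \<bullet> e}"
  let ?L = "{u::real^'n. t \<le> (u /\<^sub>R norm u) \<bullet> e}"
  have L: "?L = (\<lambda>u. u /\<^sub>R norm u) -` {w. t \<le> w \<bullet> e} \<inter> space borel"
    by auto
  have [measurable]: "?L \<in> sets borel"
    unfolding L by (rule measurable_sets[where A = borel]) auto
  \<comment> \<open>The cone \<open>?K\<close> contains boundary points of the ball and the origin.
    The set \<open>ball 0 1 \<inter> ?L\<close> omits both, the origin because 0 / 0 = 0 and t > 0.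
    These differences are null sets.\<close>
  have "sphere (0::real^'n) 1 \<in> null_sets lborel"
    using negligible_sphere[of "0::real^'n" 1]
    by (auto simp: null_sets_completion_iff negligible_iff_null_sets)
  then have "AE u in lborel. u \<notin> sphere (0::real^'n) 1"
    by (rule AE_not_in)
  moreover have "AE u in lborel. u \<noteq> (0::real^'n)"
    by (rule AE_lborel_singleton)
  ultimately have "AE u in lborel. u \<in> ball 0 1 \<inter> ?L \<longleftrightarrow> u \<in> ?K"
    by eventually_elim (auto simp: field_simps)
  then have K: "emeasure lborel (ball 0 1 \<inter> ?L) = emeasure lborel ?K"
    by (intro emeasure_eq_AE) auto
  have "emeasure uniform_sphere {w. t \<le> w \<bullet> e} = emeasure (uniform_measure lborel (ball 0 1)) ?L"
    unfolding uniform_sphere_def by (subst emeasure_distr) (auto simp: vimage_def)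
  also have "\<dots> = emeasure lborel ?K / emeasure lborel (ball (0::real^'n) 1)"
    unfolding K[symmetric] by (rule emeasure_uniform_measure) auto
  also have "\<dots> = ennreal (unit_ball_vol (2 * m) * m / (2 * m + 1) * beta_tail m t) /
      ennreal (unit_ball_vol (2 * m + 1))"
    using emeasure_half_cone[OF e _ t] dim by (simp add: emeasure_ball mult_ac flip: m_def m(2))
  also have "\<dots> = ennreal (beta_tail m t / (2 * Beta m (1 / 2)))"
    unfolding unit_ball_vol_step[OF m(1)]
  proof (subst divide_ennreal)
    have v: "unit_ball_vol (2 * m + 1) > 0" and B: "Beta m (1 / 2) > 0"
      using m(1) by (simp_all add: Beta_def)
    then show "0 \<le> unit_ball_vol (2 * m + 1) / (2 * Beta m (1 / 2)) * beta_tail m t"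
      using beta_tail_nonneg[OF m(1), of t] by simp
    show "0 < unit_ball_vol (2 * m + 1)" by (rule v)
    show "ennreal (unit_ball_vol (2 * m + 1) / (2 * Beta m (1 / 2)) * beta_tail m t / unit_ball_vol (2 * m + 1)) =
        ennreal (beta_tail m t / (2 * Beta m (1 / 2)))"
      using v by simp
  qed
  finally show ?thesis .
qed

text \<open>Rotation invariance carries a basis vector to an arbitrary unit vector.\<close>

lemma emeasure_uniform_sphere_cap:
  fixes e :: "real^'n"
  assumes e: "norm e = 1" and dim: "CARD('n) \<ge> 2" and t: "0 < t" "t < 1"
  defines "m \<equiv> (real CARD('n) - 1) / 2"
  shows "emeasure uniform_sphere {w. t \<le> w \<bullet> e} = ennreal (beta_tail m t / (2 * Beta m (1 / 2)))"
proof -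
  obtain b :: "real^'n" where b: "b \<in> Basis"
    using nonempty_Basis by blast
  then obtain T where T: "orthogonal_transformation T" "T b = e"
    using orthogonal_transformation_exists_1[of b e] e by auto
  then have "T \<in> borel_measurable borel"
    by (intro borel_measurable_continuous_onI linear_continuous_on)
       (simp add: orthogonal_transformation_linear linear_conv_bounded_linear[symmetric])
  then have "emeasure (distr uniform_sphere borel T) {w. t \<le> w \<bullet> e} =
      emeasure uniform_sphere {w. t \<le> w \<bullet> b}"
    using T by (subst emeasure_distr) (auto simp: vimage_def orthogonal_transformation_def)
  then show ?thesis
    unfolding m_def uniform_sphere_orthogonal_invariant[OF T(1)]
    using emeasure_uniform_sphere_cap_axis[OF b dim t] by simp
qed

text \<open>Since \<open>ennreal\<close> sends negative reals to 0, the integrand is a positive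
  part. It is the length of the interval from a to (w | e), so Tonelli turns its mean into the
  integral of the cap probabilities over [a, 1].\<close>

lemma nn_integral_uniform_sphere_excess:
  fixes e :: "real^'n"
  assumes e: "norm e = 1" and dim: "CARD('n) \<ge> 2" and a: "0 < a" "a < 1"
  defines "m \<equiv> (real CARD('n) - 1) / 2"
  shows "(\<integral>\<^sup>+w. ennreal (w \<bullet> e - a) \<partial>uniform_sphere) =
    ennreal (((1 - a\<^sup>2) powr m / m - a * beta_tail m a) / (2 * Beta m (1 / 2)))"
proof -
  interpret S: prob_space "uniform_sphere :: (real^'n) measure"
    by (rule prob_space_uniform_sphere)
  interpret P: pair_sigma_finite "uniform_sphere :: (real^'n) measure" "lborel :: real measure" ..
  have m: "m > 0" using dim by (simp add: m_def)
  have B: "Beta m (1 / 2) > 0" using m by (simp add: Beta_def)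
  have "(\<integral>\<^sup>+w. ennreal (w \<bullet> e - a) \<partial>uniform_sphere) =
      (\<integral>\<^sup>+w. \<integral>\<^sup>+t. indicator {a..1} t * indicator {w. t \<le> w \<bullet> e} w \<partial>lborel \<partial>uniform_sphere)"
    using AE_uniform_sphere[where 'n = 'n]
  proof (intro nn_integral_cong_AE, eventually_elim)
    case (elim w)
    have "w \<bullet> e \<le> 1"
      using norm_cauchy_schwarz[of w e] e elim by simp
    then have "(\<integral>\<^sup>+t. indicator {a..1} t * indicator {w. t \<le> w \<bullet> e} w \<partial>lborel) =
        (\<integral>\<^sup>+t. indicator {a..w \<bullet> e} t \<partial>lborel)"
      by (intro nn_integral_cong) (auto simp: indicator_def)
    also have "\<dots> = ennreal (w \<bullet> e - a)"
      by (simp add: emeasure_lborel_Icc_eq ennreal_neg)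
    finally show ?case ..
  qed
  also have "\<dots> = (\<integral>\<^sup>+t. \<integral>\<^sup>+w. indicator {a..1} t * indicator {w. t \<le> w \<bullet> e} w \<partial>uniform_sphere \<partial>lborel)"
    by (rule P.Fubini'[symmetric]) simp
  also have "\<dots> = (\<integral>\<^sup>+t. indicator {a..1} t * emeasure uniform_sphere {w. t \<le> w \<bullet> e} \<partial>lborel)"
    by (intro nn_integral_cong) (subst nn_integral_cmult, auto)
  also have "\<dots> = (\<integral>\<^sup>+t. ennreal (beta_tail m t / (2 * Beta m (1 / 2))) * indicator {a..1} t \<partial>lborel)"
    \<comment> \<open>The cap formula is available only for t < 1.\<close>
    using AE_lborel_singleton[of "1::real"]
  proof (intro nn_integral_cong_AE, eventually_elim)
    case (elim t)
    then show ?case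
      using emeasure_uniform_sphere_cap[OF e dim, of t] a by (auto simp: indicator_def m_def)
  qed
  also have "\<dots> = ennreal (((1 - a\<^sup>2) powr m / m - a * beta_tail m a) / (2 * Beta m (1 / 2)))"
    using B beta_tail_nonneg[OF m]
    by (intro nn_integral_has_integral_lebesgue' has_integral_divide has_integral_beta_tail m a) auto
  finally show ?thesis .
qed

section \<open>Uniform offsets and independence\<close>

text \<open>By Cauchy-Schwarz the interval lies inside [-k, k], so nothing is cut off. If it is
  empty, truncation by \<open>ennreal\<close> gives the right value 0.\<close>

lemma emeasure_uniform_offset_strip:
  fixes w c x :: "'a::real_inner"
  assumes w: "norm w = 1" and k: "k > 0" "norm c \<le> k" "norm x \<le> k" and "0 \<le> p" "0 \<le> r"
  shows "emeasure (uniform_measure lborel {-k..k}) {w \<bullet> x + p..w \<bullet> c - r} =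
    ennreal (w \<bullet> (c - x) - (p + r)) / ennreal (2 * k)"
proof -
  have "\<bar>w \<bullet> c\<bar> \<le> k" "\<bar>w \<bullet> x\<bar> \<le> k"
    using Cauchy_Schwarz_ineq2[of w c] Cauchy_Schwarz_ineq2[of w x] w k by auto
  then have "{-k..k} \<inter> {w \<bullet> x + p..w \<bullet> c - r} = {w \<bullet> x + p..w \<bullet> c - r}"
    using assms by auto
  then show ?thesis
    using k by (auto simp: emeasure_lborel_Icc_eq ennreal_neg inner_diff_right algebra_simps)
qed

text \<open>A product of sigma-finite measures is determined by its values on rectangles, and there
  independence is exactly the product rule.\<close>

lemma (in prob_space) distr_Pair_indep_set:
  assumes X [measurable]: "X \<in> measurable M S" and Y [measurable]: "Y \<in> measurable M T"
    and indep: "indep_set {X -` A \<inter> space M | A. A \<in> sets S} {Y -` A \<inter> space M | A. A \<in> sets T}"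
  shows "distr M (S \<Otimes>\<^sub>M T) (\<lambda>\<omega>. (X \<omega>, Y \<omega>)) = distr M S X \<Otimes>\<^sub>M distr M T Y"
proof (rule sym, rule pair_measure_eqI)
  show "sigma_finite_measure (distr M S X)" "sigma_finite_measure (distr M T Y)"
    by (intro prob_space_imp_sigma_finite prob_space_distr X Y)+
  fix A B assume "A \<in> sets (distr M S X)" "B \<in> sets (distr M T Y)"
  then have [measurable]: "A \<in> sets S" "B \<in> sets T" by simp_all
  have "prob ((X -` A \<inter> space M) \<inter> (Y -` B \<inter> space M)) =
      prob (X -` A \<inter> space M) * prob (Y -` B \<inter> space M)"
    by (rule indep_setD[OF indep]) auto
  also have "(X -` A \<inter> space M) \<inter> (Y -` B \<inter> space M) = (\<lambda>\<omega>. (X \<omega>, Y \<omega>)) -` (A \<times> B) \<inter> space M"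
    by auto
  finally show "emeasure (distr M S X) A * emeasure (distr M T Y) B =
      emeasure (distr M (S \<Otimes>\<^sub>M T) (\<lambda>\<omega>. (X \<omega>, Y \<omega>))) (A \<times> B)"
    by (simp add: emeasure_distr emeasure_eq_measure ennreal_mult)
qed simp

section \<open>The separation probability\<close>

theorem theoremV:
  fixes c x :: "real^'n" and p r \<delta> k :: real
    and M :: "'o measure" and W :: "'o \<Rightarrow> real^'n" and \<beta> :: "'o \<Rightarrow> real"
  assumes "CARD('n) \<ge> 2"
    and "p > 0" and "r > 0" and "\<delta> > 0"
    and "norm (c - x) = p + r + \<delta>"
    and "k \<ge> max (norm c) (norm x)"
    and "prob_space M"
    and "W \<in> borel_measurable M" and "\<beta> \<in> borel_measurable M"
    and "distr M borel W = uniform_sphere"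
    and "distr M borel \<beta> = uniform_measure lborel {-k..k}"
    and "prob_space.indep_set M {W -` A \<inter> space M | A. A \<in> sets borel}
           {\<beta> -` A \<inter> space M | A. A \<in> sets borel}"
  shows "let n = real CARD('n); Q = 1 - ((p + r) / (p + r + \<delta>))\<^sup>2 in
    measure M {\<omega> \<in> space M. hyperplane_separates (W \<omega>) (\<beta> \<omega>) (ball c r) (ball x p)} =
      norm (c - x) / (2 * k) *
        (Q powr ((n - 1) / 2) / ((n - 1) / 2 * Beta ((n - 1) / 2) (1 / 2))
         - (p + r) / (p + r + \<delta>) * regularized_beta Q ((n - 1) / 2) (1 / 2))"
proof -
  note dim = assms(1) and p = assms(2) and r = assms(3) and \<delta> = assms(4)
    and W [measurable] = assms(8) and \<beta> [measurable] = assms(9)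
  interpret prob_space M by fact
  define d where "d = norm (c - x)"
  define a where "a = (p + r) / d"
  define m where "m = (real CARD('n) - 1) / 2"
  define U where "U = uniform_measure lborel {-k..k}"
  define I where "I = ((1 - a\<^sup>2) powr m / m - a * beta_tail m a) / (2 * Beta m (1 / 2))"
  have d: "d = p + r + \<delta>" "d > 0" "norm (x - c) = d"
    using assms by (simp_all add: d_def norm_minus_commute)
  have a: "0 < a" "a < 1" using d p r \<delta> by (simp_all add: a_def)
  have m: "m > 0" using dim by (simp add: m_def)
  \<comment> \<open>Positivity of k follows from 0 < d = |c - x| \<le> |c| + |x| \<le> 2k.\<close>
  have k: "k > 0" "norm c \<le> k" "norm x \<le> k"
    using assms(6) norm_triangle_ineq4[of c x] d unfolding d_def by linarith+
  have B: "Beta m (1 / 2) > 0" using m by (simp add: Beta_def)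
  have sets_U [measurable_cong, simp]: "sets U = sets borel" by (simp add: U_def)
  interpret U: prob_space U
    unfolding U_def using k by (intro prob_space_uniform_measure) auto

  have joint: "distr M (borel \<Otimes>\<^sub>M borel) (\<lambda>\<omega>. (W \<omega>, \<beta> \<omega>)) = uniform_sphere \<Otimes>\<^sub>M U"
    using distr_Pair_indep_set[OF W \<beta> assms(12)] assms(10,11) by (simp add: U_def)

  define E where "E = {(w, b). hyperplane_separates w b (ball c r) (ball x p)}"
  have "Measurable.pred (borel \<Otimes>\<^sub>M borel) (\<lambda>(w, b). hyperplane_separates w b (ball c r) (ball x p))"
    unfolding hyperplane_separates_balls_iff[OF r p] atLeastAtMost_iff case_prod_beta by measurable
  then have E [measurable]: "E \<in> sets (borel \<Otimes>\<^sub>M borel)"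
    by (simp add: E_def pred_def space_pair_measure)
  have E_iff: "(w, b) \<in> E \<longleftrightarrow> hyperplane_separates w b (ball c r) (ball x p)" for w b
    by (simp add: E_def)
  \<comment> \<open>Scaling to the unit vector y / d pulls out the factor d. The general y serves
    both c - x and x - c, one for each side on which the first ball can lie.\<close>
  have excess: "(\<integral>\<^sup>+w. ennreal (w \<bullet> y - (p + r)) \<partial>uniform_sphere) = ennreal (d * I)"
    if y: "norm y = d" for y :: "real^'n"
  proof -
    have "ennreal (w \<bullet> y - (p + r)) = ennreal d * ennreal (w \<bullet> (y /\<^sub>R d) - a)" for w
    proof -
      have "w \<bullet> y - (p + r) = d * (w \<bullet> (y /\<^sub>R d) - a)"
        using d(2) by (simp add: a_def right_diff_distrib)
      then show ?thesis
        using d(2) by (simp only: ennreal_mult' less_imp_le)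
    qed
    then have "(\<integral>\<^sup>+w. ennreal (w \<bullet> y - (p + r)) \<partial>uniform_sphere) =
        ennreal d * (\<integral>\<^sup>+w. ennreal (w \<bullet> (y /\<^sub>R d) - a) \<partial>uniform_sphere)"
      by (simp only:) (subst nn_integral_cmult, auto)
    also have "(\<integral>\<^sup>+w. ennreal (w \<bullet> (y /\<^sub>R d) - a) \<partial>uniform_sphere) = ennreal I"
      unfolding I_def m_def using y d(2) by (intro nn_integral_uniform_sphere_excess dim a) auto
    finally show ?thesis using d(2) by (simp add: ennreal_mult')
  qed
  \<comment> \<open>Needed to pass from \<open>ennreal\<close> back to real numbers without
    truncation.\<close>
  have I: "I \<ge> 0"
  proof -
    have "0 \<le> (1 - a\<^sup>2) powr m / m - a * beta_tail m a"
      by (rule has_integral_nonneg[OF has_integral_beta_tail[OF m a]]) (rule beta_tail_nonneg[OF m])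
    then show ?thesis using B by (simp add: I_def)
  qed

  have "emeasure M {\<omega> \<in> space M. hyperplane_separates (W \<omega>) (\<beta> \<omega>) (ball c r) (ball x p)} =
      emeasure (uniform_sphere \<Otimes>\<^sub>M U) E"
    unfolding joint[symmetric] by (subst emeasure_distr) (auto simp: E_iff intro!: arg_cong[where f = "emeasure M"])
  also have "\<dots> = (\<integral>\<^sup>+w. emeasure U (Pair w -` E) \<partial>uniform_sphere)"
    by (rule U.emeasure_pair_measure_alt) simp
  also have "\<dots> = (\<integral>\<^sup>+w. (ennreal (w \<bullet> (c - x) - (p + r)) + ennreal (w \<bullet> (x - c) - (p + r))) / ennreal (2 * k)
      \<partial>uniform_sphere)"
    using AE_uniform_sphere[where 'n = 'n]
  proof (intro nn_integral_cong_AE, eventually_elim)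
    case (elim w)
    let ?A = "{w \<bullet> x + p..w \<bullet> c - r}" and ?B = "{w \<bullet> c + r..w \<bullet> x - p}"
    have "Pair w -` E = ?A \<union> ?B"
      using elim by (auto simp: E_def hyperplane_separates_balls_iff[OF r p])
    \<comment> \<open>A point of \<open>?A\<close> forces (w | x) < (w | c), a point of
      \<open>?B\<close> the reverse.\<close>
    moreover have "?A \<inter> ?B = {}"
      using r p by auto
    ultimately have "emeasure U (Pair w -` E) = emeasure U ?A + emeasure U ?B"
      by (simp add: plus_emeasure)
    also have "\<dots> = ennreal (w \<bullet> (c - x) - (p + r)) / ennreal (2 * k) +
        ennreal (w \<bullet> (x - c) - (r + p)) / ennreal (2 * k)"
      unfolding U_def using emeasure_uniform_offset_strip[of w k c x p r]
        emeasure_uniform_offset_strip[of w k x c r p] elim k p r by simp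
    finally show ?case
      by (simp add: add_divide_distrib_ennreal add.commute)
  qed
  also have "\<dots> = (ennreal (d * I) + ennreal (d * I)) / ennreal (2 * k)"
    using d by (simp add: nn_integral_divide nn_integral_add excess d_def[symmetric])
  also have "\<dots> = ennreal (2 * (d * I) / (2 * k))"
    using I d(2) k by (simp add: divide_ennreal flip: ennreal_plus)
  finally have "measure M {\<omega> \<in> space M. hyperplane_separates (W \<omega>) (\<beta> \<omega>) (ball c r) (ball x p)} =
      2 * (d * I) / (2 * k)"
    using I d(2) k by (simp add: measure_def)
  \<comment> \<open>The 2 from the two sides cancels the 2 in the denominator of \<open>I\<close>,
    and \<open>beta_tail m a\<close> divided by the beta function is the regularized beta function
    at 1 - a^2, the Q of the statement.\<close>
  also have "\<dots> = d / (2 * k) * ((1 - a\<^sup>2) powr m / (m * Beta m (1 / 2)) - a * regularized_beta (1 - a\<^sup>2) m (1 / 2))"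
    using B m k by (simp add: I_def regularized_beta_def beta_tail_def field_simps)
  finally show ?thesis
    unfolding Let_def by (simp add: a_def d(1) m_def flip: assms(5))
qed

end
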